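(* Let $F\subset\mathbb{R}^n$ be a closed, bounded, convex set with $0\in\operatorname{int}F$, and let $\{Q_i\}_{i=1}^p$ be a finite collection of nonempty convex compact sets in $\mathbb{R}^n$. Then $$T_F\Big(0;\sum_{i=1}^p Q_i\Big)=-\min\Big\{\sum_{i=1}^p\sigma_{Q_i}(-u):\ u\in F^\circ\Big\}.$$ Moreover, if the minimum on the right-hand side is attained at $\bar u\in F^\circ$, then any generalized projection $\bar q\in\Pi_F\big(0;\sum_{i=1}^pQ_i\big)$ of the origin onto $\sum_{i=1}^p Q_i$ satisfies $$\bar q\in S_{Q_1}(-\bar u)+\dots+S_{Q_p}(-\bar u).$$ Thus $\bar q$ is a sum $\bar q=q_1+\dots+q_p$ of points $q_i\in Q_i$ such that at these points all the sets have the same normal vector $-\bar u$, i.e. $-\bar u\in N(q_i;Q_i)$ for every $i=1,\dots,p$. If $F=\mathbb{B}$ is the Euclidean closed unit ball, then the projection $\bar q$ of the origin onto $\sum_{i=1}^pQ_i$ exists uniquely and $$d\Big(0;\sum_{i=1}^pQ_i\Big)=-\min\Big\{\sum_{i=1}^p\sigma_{Q_i}(-u):\ u\in\mathbb{B}\Big\}.$$ If in addition $0\notin\sum_{i=1}^pQ_i$, then $\bar q/\|\bar q\|$ is the unique solution of the dual problem (the unique minimizer of $\sum_{i=1}^p\sigma_{Q_i}(-u)$ over $u\in\mathbb{B}$), and $$\bar q\in S_{Q_1}(-\bar q)+\dots+S_{Q_p}(-\bar q).$$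
   Context: $\langle\cdot,\cdot\rangle$ and $\|\cdot\|$ are the Euclidean inner product and norm. $\sum_i Q_i$ is the Minkowski sum $\{\sum_i q_i: q_i\in Q_i\}$. For a set $Q\subset\mathbb{R}^n$: the support function is $\sigma_Q(u)=\sup\{\langle u,x\rangle: x\in Q\}$; the support point set is $S_Q(u)=\{x\in Q:\langle u,x\rangle=\sigma_Q(u)\}$; the Euclidean distance is $d(x;Q)=\inf\{\|q-x\|: q\in Q\}$; the normal cone of a convex set $Q$ at $\bar x\in Q$ is $N(\bar x;Q)=\{u:\langle u,x-\bar x\rangle\le 0\ \forall x\in Q\}$. The polar of $F$ is $F^\circ=\{u:\sigma_F(u)\le 1\}$. The Minkowski function is $\rho_F(x)=\inf\{t\ge 0: x\in tF\}$. The minimal time function (generalized distance) is $T_F(x;Q)=\inf\{t\ge0:(x+tF)\cap Q\ne\emptyset\}=\inf\{\rho_F(q-x): q\in Q\}$, and the generalized projection set is $\Pi_F(x;Q)=\{q\in Q:\rho_F(q-x)=T_F(x;Q)\}$. *)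

theory Defs
  imports "HOL-Analysis.Analysis"
begin

text \<open>
  Suprema and infima are taken in the extended reals, so that unbounded and empty sets get the
  usual values. Minkowski sums are the sums of sets from \<^theory>\<open>HOL-Library.Set_Algebras\<close>;
  see the fact \<open>set_sum_alt\<close> for the description as the set of all sums of selected points.
\<close>

definition support_fun :: "(real^'n) set \<Rightarrow> real^'n \<Rightarrow> ereal"
  where "support_fun Q u = (SUP x\<in>Q. ereal (u \<bullet> x))"

definition support_points :: "(real^'n) set \<Rightarrow> real^'n \<Rightarrow> (real^'n) set"
  where "support_points Q u = {x \<in> Q. ereal (u \<bullet> x) = support_fun Q u}"

text \<open>Only meaningful for convex \<open>Q\<close> and base points in \<open>Q\<close>.\<close>

definition normal_cone :: "real^'n \<Rightarrow> (real^'n) set \<Rightarrow> (real^'n) set"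
  where "normal_cone xb Q = {u. \<forall>x\<in>Q. u \<bullet> (x - xb) \<le> 0}"

definition polar_set :: "(real^'n) set \<Rightarrow> (real^'n) set"
  where "polar_set F = {u. support_fun F u \<le> 1}"

definition minkowski_fun :: "(real^'n) set \<Rightarrow> real^'n \<Rightarrow> ereal"
  where "minkowski_fun F x = Inf {ereal t | t. t \<ge> 0 \<and> x \<in> (*\<^sub>R) t ` F}"

definition minimal_time :: "(real^'n) set \<Rightarrow> real^'n \<Rightarrow> (real^'n) set \<Rightarrow> ereal"
  where "minimal_time F x Q =
    Inf {ereal t | t. t \<ge> 0 \<and> (+) x ` ((*\<^sub>R) t ` F) \<inter> Q \<noteq> {}}"

lemma minimal_time_eq_INF_minkowski:
  "minimal_time F x Q = (INF q\<in>Q. minkowski_fun F (q - x))"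
proof -
  have "{ereal t | t. t \<ge> 0 \<and> (+) x ` ((*\<^sub>R) t ` F) \<inter> Q \<noteq> {}} =
      (\<Union>q\<in>Q. {ereal t | t. t \<ge> 0 \<and> q - x \<in> (*\<^sub>R) t ` F})"
    by (fastforce simp: image_iff algebra_simps)
  then show ?thesis
    unfolding minimal_time_def minkowski_fun_def
    by (auto intro!: antisym Inf_greatest INF_greatest intro: Inf_lower INF_lower2)
qed

definition gen_projection :: "(real^'n) set \<Rightarrow> real^'n \<Rightarrow> (real^'n) set \<Rightarrow> (real^'n) set"
  where "gen_projection F x Q = {q \<in> Q. minkowski_fun F (q - x) = minimal_time F x Q}"

definition euclidean_projection :: "real^'n \<Rightarrow> (real^'n) set \<Rightarrow> (real^'n) set"
  where "euclidean_projection x Q = {q \<in> Q. norm (q - x) = infdist x Q}"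

definition dual_objective :: "nat \<Rightarrow> (nat \<Rightarrow> (real^'n) set) \<Rightarrow> real^'n \<Rightarrow> ereal"
  where "dual_objective p Q u = (\<Sum>i\<in>{1..p}. support_fun (Q i) (- u))"

end

theory Submission
  imports Defs
begin

text \<open>Write S for the Minkowski sum of the Q_i. A linear functional is maximized over S
  summand by summand, so the dual objective at u is the support function of S at -u
  (\<open>support_fun_sum\<close>), and everything reduces to the single compact convex set S.

  For u in the polar of F, the bound <u,q> \<le> \<rho>_F(q) for every q in S gives -T_F(0;S) \<le>
  \<sigma>_S(-u) (\<open>weak_duality\<close>). Equality holds for some u: S misses T int F, where T
  > 0 is the minimal time, and a separating hyperplane, suitably normalized, supplies u
  (\<open>strong_duality\<close>). Hence the minimizers are exactly the polar points without duality
  gap. At such a point a generalized projection turns the chain of inequalities into equalities, so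
  it maximizes -u over S, and \<open>support_points_sum\<close> splits it into maximizers over the
  Q_i.

  For the unit ball, \<rho>_F is the norm and the polar is the ball itself. The absence of a gap
  then reads <u,q> = |q| with |u| \<le> 1, the equality case of Cauchy-Schwarz, which forces u =
  q/|q| when q is nonzero.\<close>

section \<open>Support functions and support points of Minkowski sums\<close>

text \<open>Replaces the supremum in \<open>ereal\<close> by real inequalities: a point of Q attains
  the supremum precisely when it is an upper bound for it.\<close>

lemma mem_support_points_iff:
  "x \<in> support_points Q u \<longleftrightarrow> x \<in> Q \<and> (\<forall>y\<in>Q. u \<bullet> y \<le> u \<bullet> x)"
proof -
  have "ereal (u \<bullet> x) = support_fun Q u \<longleftrightarrow> (\<forall>y\<in>Q. u \<bullet> y \<le> u \<bullet> x)" if "x \<in> Q"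
  proof -
    have "ereal (u \<bullet> x) \<le> support_fun Q u"
      unfolding support_fun_def using that by (rule SUP_upper)
    then have "ereal (u \<bullet> x) = support_fun Q u \<longleftrightarrow> support_fun Q u \<le> ereal (u \<bullet> x)"
      by auto
    then show ?thesis
      by (simp add: support_fun_def SUP_le_iff)
  qed
  then show ?thesis
    by (auto simp: support_points_def)
qed

lemma support_fun_eq_inner:
  "x \<in> support_points Q u \<Longrightarrow> support_fun Q u = ereal (u \<bullet> x)"
  by (simp add: support_points_def)

lemma support_points_nonempty:
  assumes "compact Q" "Q \<noteq> {}"
  shows "support_points Q u \<noteq> {}"
proof -
  have "continuous_on Q (\<lambda>x. u \<bullet> x)"
    by (intro continuous_intros)
  then obtain x where "x \<in> Q" "\<forall>y\<in>Q. u \<bullet> y \<le> u \<bullet> x"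
    using continuous_attains_sup[OF assms] by blast
  then show ?thesis
    using mem_support_points_iff by blast
qed

text \<open>Allows the unit vector in direction -q, which duality yields, to be replaced by -q
  itself.\<close>

lemma support_points_scaleR:
  assumes "c > 0"
  shows "support_points Q (c *\<^sub>R u) = support_points Q u"
  using assms by (auto simp: mem_support_points_iff)

lemma support_points_imp_normal_cone:
  "x \<in> support_points Q u \<Longrightarrow> u \<in> normal_cone x Q"
  by (auto simp: mem_support_points_iff normal_cone_def inner_diff_right)

text \<open>The summands can be chosen independently, so a sum is maximal exactly when each summand
  is.\<close>

lemma support_points_sum:
  fixes Q :: "'i \<Rightarrow> (real^'n) set"
  assumes "finite I"
  shows "support_points (\<Sum>i\<in>I. Q i) u = (\<Sum>i\<in>I. support_points (Q i) u)" (is "?L = ?R")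
proof
  show "?R \<subseteq> ?L"
  proof
    fix x assume "x \<in> ?R"
    then obtain s where s: "x = sum s I" "\<And>i. i \<in> I \<Longrightarrow> s i \<in> support_points (Q i) u"
      by (auto simp: set_sum_alt[OF assms])
    have "u \<bullet> sum t I \<le> u \<bullet> sum s I" if "\<And>i. i \<in> I \<Longrightarrow> t i \<in> Q i" for t
      using s(2) that by (auto simp: inner_sum_right mem_support_points_iff intro!: sum_mono)
    then show "x \<in> ?L"
      using s by (auto simp: mem_support_points_iff set_sum_alt[OF assms])
  qed
  show "?L \<subseteq> ?R"
  proof
    fix x assume x: "x \<in> ?L"
    then obtain s where s: "x = sum s I" "\<And>i. i \<in> I \<Longrightarrow> s i \<in> Q i"
      by (auto simp: mem_support_points_iff set_sum_alt[OF assms])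
    have "u \<bullet> y \<le> u \<bullet> s i" if i: "i \<in> I" and y: "y \<in> Q i" for i y
    proof -
      \<comment> \<open>Exchange argument: replace the i-th summand alone by y, compare with the
        maximal sum, and cancel the common remaining terms.\<close>
      have "sum (s(i := y)) I \<in> (\<Sum>i\<in>I. Q i)"
        unfolding set_sum_alt[OF assms] using s(2) y by auto
      then have "u \<bullet> sum (s(i := y)) I \<le> u \<bullet> sum s I"
        using x s(1) by (simp add: mem_support_points_iff)
      moreover have "sum (s(i := y)) I = y + sum s (I - {i})"
        using assms i by (simp add: sum.remove)
      moreover have "sum s I = s i + sum s (I - {i})"
        using assms i by (simp add: sum.remove)
      ultimately show ?thesis
        by (simp add: inner_add_right)
    qed
    then show "x \<in> ?R"
      using s by (auto simp: mem_support_points_iff set_sum_alt[OF assms])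
  qed
qed

text \<open>By compactness each supremum is attained, and the sum of the maximizers is a maximizer
  over the Minkowski sum. Attainment also makes all values finite, so the sum in
  \<open>ereal\<close> is an ordinary real sum.\<close>

lemma support_fun_sum:
  fixes Q :: "'i \<Rightarrow> (real^'n) set"
  assumes "finite I" "\<And>i. i \<in> I \<Longrightarrow> compact (Q i)" "\<And>i. i \<in> I \<Longrightarrow> Q i \<noteq> {}"
  shows "support_fun (\<Sum>i\<in>I. Q i) u = (\<Sum>i\<in>I. support_fun (Q i) u)"
proof -
  have "\<forall>i\<in>I. \<exists>x. x \<in> support_points (Q i) u"
    by (simp add: ex_in_conv support_points_nonempty assms)
  then obtain s where s: "\<And>i. i \<in> I \<Longrightarrow> s i \<in> support_points (Q i) u"
    by (metis bchoice)
  then have "sum s I \<in> (\<Sum>i\<in>I. support_points (Q i) u)"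
    by (auto simp: set_sum_alt[OF assms(1)])
  then have "sum s I \<in> support_points (\<Sum>i\<in>I. Q i) u"
    using support_points_sum[OF assms(1)] by blast
  then have "support_fun (\<Sum>i\<in>I. Q i) u = ereal (\<Sum>i\<in>I. u \<bullet> s i)"
    by (simp add: support_fun_eq_inner inner_sum_right)
  also have "\<dots> = (\<Sum>i\<in>I. support_fun (Q i) u)"
    by (simp add: support_fun_eq_inner[OF s] flip: sum_ereal)
  finally show ?thesis .
qed

lemma compact_set_sum:
  fixes Q :: "'i \<Rightarrow> (real^'n) set"
  assumes "\<And>i. i \<in> I \<Longrightarrow> compact (Q i)"
  shows "compact (\<Sum>i\<in>I. Q i)"
  using assms
proof (induction I rule: infinite_finite_induct)
  case (insert i I)
  then have "compact {x + y |x y. x \<in> Q i \<and> y \<in> (\<Sum>i\<in>I. Q i)}"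
    by (intro compact_sums) auto
  moreover have "{x + y |x y. x \<in> Q i \<and> y \<in> (\<Sum>i\<in>I. Q i)} = Q i + (\<Sum>i\<in>I. Q i)"
    by (auto simp: set_plus_def)
  ultimately show ?case
    using insert by simp
\<comment> \<open>For an empty or infinite index set the sum is the zero of set addition, the
  singleton of the origin.\<close>
qed (auto simp: set_zero)

section \<open>Polar sets and the Minkowski function\<close>

lemma inner_le_of_mem_polar_set: "u \<in> polar_set F \<Longrightarrow> x \<in> F \<Longrightarrow> u \<bullet> x \<le> 1"
  by (simp add: polar_set_def support_fun_def SUP_le_iff one_ereal_def)

text \<open>If x = t f with f in F and t \<ge> 0, then <u,x> = t <u,f> \<le> t; the infimum over t
  inherits the bound.\<close>

lemma inner_le_minkowski_fun:
  assumes "u \<in> polar_set F"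
  shows "ereal (u \<bullet> x) \<le> minkowski_fun F x"
  unfolding minkowski_fun_def
proof (rule Inf_greatest, clarify)
  fix t :: real and f assume "t \<ge> 0" "f \<in> F"
  then show "ereal (u \<bullet> (t *\<^sub>R f)) \<le> ereal t"
    using inner_le_of_mem_polar_set[OF assms \<open>f \<in> F\<close>] by (simp add: mult_left_le)
qed

lemma minkowski_fun_le: "t \<ge> 0 \<Longrightarrow> f \<in> F \<Longrightarrow> minkowski_fun F (t *\<^sub>R f) \<le> ereal t"
  unfolding minkowski_fun_def by (intro Inf_lower) auto

text \<open>F contains a ball around the origin, and a large enough dilate of that ball contains
  x.\<close>

lemma minkowski_fun_less_top:
  assumes "0 \<in> interior F"
  shows "minkowski_fun F x < \<infinity>"
proof -
  obtain r where r: "r > 0" "cball 0 r \<subseteq> F"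
    using assms by (auto simp: mem_interior_cball)
  \<comment> \<open>The summand 1 keeps t positive when x = 0, so that dividing by t is
    legitimate.\<close>
  define t where "t = norm x / r + 1"
  have t: "t > 0" and "norm x \<le> r * t"
    using r by (auto simp: t_def field_simps add_pos_nonneg)
  then have "norm (x /\<^sub>R t) \<le> r"
    by (simp add: field_simps)
  then have "x /\<^sub>R t \<in> F"
    using r by auto
  from minkowski_fun_le[OF _ this, of t] t have "minkowski_fun F x \<le> ereal t"
    by simp
  then show ?thesis
    using le_less_trans less_ereal.simps(4) by blast
qed

section \<open>Weak and strong duality\<close>

text \<open>For q in S, -\<sigma>_S(-u) \<le> <u,q> \<le> \<rho>_F(q); the infimum over q gives the
  claim.\<close>

lemma weak_duality:
  assumes "u \<in> polar_set F"
  shows "- minimal_time F 0 S \<le> support_fun S (- u)"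
proof -
  have "- support_fun S (- u) \<le> minkowski_fun F q" if "q \<in> S" for q
  proof -
    have "ereal (- u \<bullet> q) \<le> support_fun S (- u)"
      unfolding support_fun_def using that by (rule SUP_upper)
    then have "- support_fun S (- u) \<le> ereal (u \<bullet> q)"
      by (subst ereal_uminus_le_reorder) simp
    also have "\<dots> \<le> minkowski_fun F q"
      using assms by (rule inner_le_minkowski_fun)
    finally show ?thesis .
  qed
  then have "- support_fun S (- u) \<le> minimal_time F 0 S"
    unfolding minimal_time_eq_INF_minkowski by (intro INF_greatest) simp
  then show ?thesis
    by (subst ereal_uminus_le_reorder)
qed

text \<open>
  The dual solution is the normal of a hyperplane separating \<open>S\<close> from the interior of \<open>T F\<close>,
  where \<open>T\<close> is the minimal time.
\<close>

lemma strong_duality: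
  fixes F S :: "(real^'n) set"
  assumes F: "closed F" "convex F" "0 \<in> interior F" and S: "convex S" "S \<noteq> {}"
  obtains u where "u \<in> polar_set F" "support_fun S (- u) \<le> - minimal_time F 0 S"
proof -
  let ?T = "minimal_time F 0 S"
  have le: "?T \<le> minkowski_fun F q" if "q \<in> S" for q
    unfolding minimal_time_eq_INF_minkowski using INF_lower[OF that, of "\<lambda>q. minkowski_fun F (q - 0)"]
    by simp
  have "?T \<ge> 0"
    unfolding minimal_time_def by (intro Inf_greatest) auto
  moreover have "?T < \<infinity>"
    using S(2) le minkowski_fun_less_top[OF F(3)] by (meson ex_in_conv le_less_trans)
  ultimately obtain T where T: "?T = ereal T" "T \<ge> 0"
    by (cases ?T) auto
  show thesis
  \<comment> \<open>When T = 0 the dilate of int F collapses to the origin, and u = 0 already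
    serves.\<close>
  proof (cases "T = 0")
    case True
    have "0 \<in> polar_set F" "support_fun S (- 0) \<le> - ?T"
      using T True by (auto simp: polar_set_def support_fun_def SUP_le_iff zero_ereal_def)
    then show ?thesis
      using that by blast
  next
    case False
    then have T0: "T > 0"
      using T by simp
    \<comment> \<open>If T f lies in S with f interior to F, a slightly longer multiple of f still
      lies in F, so T f is reached in a time shorter than T.\<close>
    have disj: "(*\<^sub>R) T ` interior F \<inter> S = {}"
    proof (rule ccontr)
      assume "(*\<^sub>R) T ` interior F \<inter> S \<noteq> {}"
      then obtain f where f: "f \<in> interior F" "T *\<^sub>R f \<in> S"
        by auto
      obtain e where e: "e > 0" "ball f e \<subseteq> F"
        using f(1) by (auto simp: mem_interior)
      \<comment> \<open>Stretching f by 1 + d moves it by d |f| < e; the added 1 covers f =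
        0.\<close>
      define d where "d = e / (norm f + 1)"
      have np: "norm f + 1 > 0"
        using norm_ge_zero[of f] by linarith
      then have d: "d > 0" and de: "d * norm f < e"
        using e(1) by (auto simp: d_def divide_simps)
      have "(1 + d) *\<^sub>R f \<in> ball f e"
        using d de by (simp add: dist_norm algebra_simps)
      then have F': "(1 + d) *\<^sub>R f \<in> F"
        using e by blast
      have "minkowski_fun F (T *\<^sub>R f) \<le> ereal (T / (1 + d))"
        using minkowski_fun_le[OF _ F', of "T / (1 + d)"] d T by simp
      also have "\<dots> < ereal T"
        using d T0 by (simp add: divide_simps)
      finally show False
        using le[OF f(2)] T by simp
    qed
    have "convex ((*\<^sub>R) T ` interior F)" "(*\<^sub>R) T ` interior F \<noteq> {}"
      using F by (auto intro: convex_scaling convex_interior)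
    from separating_hyperplane_sets[OF this(1) S(1) this(2) S(2) disj]
    obtain a b where ab: "a \<noteq> 0" "\<And>f. f \<in> interior F \<Longrightarrow> a \<bullet> (T *\<^sub>R f) \<le> b"
        "\<And>x. x \<in> S \<Longrightarrow> b \<le> a \<bullet> x"
      by auto
    \<comment> \<open>Separation bounds a only on the interior. Since F is closed and convex with
      nonempty interior, the bound extends to F by closure.\<close>
    have "closure (interior F) = F"
      using F convex_closure_interior closure_closed by fastforce
    moreover have "closure (interior F) \<subseteq> {x. (T *\<^sub>R a) \<bullet> x \<le> b}"
      using ab(2) by (intro closure_minimal closed_halfspace_le) auto
    ultimately have F_le: "T * (a \<bullet> f) \<le> b" if "f \<in> F" for f
      using that by auto
    \<comment> \<open>Needed to normalize by b: F contains a positive multiple of a, at which the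
      separated functional is positive.\<close>
    have b0: "b > 0"
    proof -
      obtain r where r: "r > 0" "cball 0 r \<subseteq> F"
        using F(3) by (auto simp: mem_interior_cball)
      have "(r / norm a) *\<^sub>R a \<in> F"
        using r ab(1) by (intro subsetD[OF r(2)]) simp
      then have "T * (a \<bullet> ((r / norm a) *\<^sub>R a)) \<le> b"
        by (rule F_le)
      moreover have "T * (a \<bullet> ((r / norm a) *\<^sub>R a)) > 0"
        using T0 r ab(1) by simp
      ultimately show ?thesis
        by linarith
    qed
    \<comment> \<open>This scaling turns T <a,f> \<le> b on F into <u,f> \<le> 1, and b \<le> <a,x>
      on S into T \<le> <u,x>.\<close>
    define u where "u = (T / b) *\<^sub>R a"
    have "u \<in> polar_set F"
      using F_le b0 by (auto simp: polar_set_def support_fun_def SUP_le_iff one_ereal_def u_def field_simps)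
    moreover have "T \<le> u \<bullet> x" if "x \<in> S" for x
      using mult_left_mono[OF ab(3)[OF that], of T] T b0 by (simp add: u_def field_simps)
    then have "support_fun S (- u) \<le> - ?T"
      using T by (simp add: support_fun_def SUP_le_iff)
    ultimately show ?thesis
      using that by blast
  qed
qed

section \<open>The Euclidean unit ball\<close>

lemma minkowski_fun_cball: "minkowski_fun (cball 0 1) x = ereal (norm x)"
proof (rule antisym)
  \<comment> \<open>The convention \<open>sgn 0 = 0\<close> makes this polar decomposition valid at
    the origin too.\<close>
  have "x = norm x *\<^sub>R sgn x"
    by (cases "x = 0") (simp_all add: sgn_div_norm)
  moreover have "sgn x \<in> cball 0 1"
    by (simp add: norm_sgn)
  ultimately show "minkowski_fun (cball 0 1) x \<le> ereal (norm x)"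
    by (metis minkowski_fun_le norm_ge_zero)
  show "ereal (norm x) \<le> minkowski_fun (cball 0 1) x"
    unfolding minkowski_fun_def by (rule Inf_greatest) (auto simp: mult_left_le)
qed

text \<open>Self-duality of the Euclidean norm: testing u against its own direction gives one
  inclusion, Cauchy-Schwarz the other.\<close>

lemma polar_set_cball: "polar_set (cball 0 1) = cball 0 1"
proof (intro equalityI subsetI)
  fix u :: "real^'n" assume "u \<in> polar_set (cball 0 1)"
  from inner_le_of_mem_polar_set[OF this, of "sgn u"] have "u \<bullet> sgn u \<le> 1"
    by (simp add: norm_sgn)
  moreover have "u \<bullet> sgn u = norm u"
    by (cases "u = 0") (simp_all add: sgn_div_norm dot_square_norm power2_eq_square)
  ultimately show "u \<in> cball 0 1"
    by simp
next
  fix u :: "real^'n" assume u: "u \<in> cball 0 1"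
  have "u \<bullet> x \<le> 1" if "norm x \<le> 1" for x
    using norm_cauchy_schwarz[of u x] mult_mono[of "norm u" 1 "norm x" 1] u that by simp
  then show "u \<in> polar_set (cball 0 1)"
    by (simp add: polar_set_def support_fun_def SUP_le_iff one_ereal_def)
qed

text \<open>Both sides are the infimum of |q - x| over S. Nonemptiness matters:
  \<open>infdist\<close> to the empty set is 0, whereas the minimal time is \<infinity>.\<close>

lemma minimal_time_cball:
  assumes "closed S" "S \<noteq> {}"
  shows "minimal_time (cball 0 1) x S = ereal (infdist x S)"
proof (rule antisym)
  obtain q where "q \<in> S" "infdist x S = dist x q"
    using infdist_attains_inf[OF assms] by blast
  then show "minimal_time (cball 0 1) x S \<le> ereal (infdist x S)"
    unfolding minimal_time_eq_INF_minkowski minkowski_fun_cball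
    by (auto intro!: INF_lower2[of q] simp: dist_norm norm_minus_commute)
  show "ereal (infdist x S) \<le> minimal_time (cball 0 1) x S"
    unfolding minimal_time_eq_INF_minkowski minkowski_fun_cball
    by (intro INF_greatest) (metis dist_norm ereal_less_eq(3) infdist_le norm_minus_commute)
qed

lemma gen_projection_cball:
  assumes "closed S" "S \<noteq> {}"
  shows "gen_projection (cball 0 1) x S = euclidean_projection x S"
  by (simp add: gen_projection_def euclidean_projection_def minkowski_fun_cball
      minimal_time_cball[OF assms])

lemma euclidean_projection_unique:
  assumes "closed S" "convex S" "S \<noteq> {}"
  obtains q where "euclidean_projection x S = {q}"
proof -
  obtain q where q: "q \<in> S" "infdist x S = dist x q"
    using infdist_attains_inf[OF assms(1,3)] by blast
  have "y = q" if "y \<in> euclidean_projection x S" for y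
    using that q infdist_le[of _ S x]
    by (intro any_closest_point_unique[OF assms(2,1), of y q x])
      (auto simp: euclidean_projection_def dist_norm norm_minus_commute)
  moreover have "q \<in> euclidean_projection x S"
    using q by (simp add: euclidean_projection_def dist_norm norm_minus_commute)
  ultimately show thesis
    using that by blast
qed

section \<open>Duality and optimality conditions for the sum\<close>

theorem corollary4p7:
  fixes F :: "(real^'n) set" and Q :: "nat \<Rightarrow> (real^'n) set" and p :: nat
  assumes "closed F" and "bounded F" and "convex F" and "0 \<in> interior F"
    and "p \<ge> 1"
    and "\<And>i. i \<in> {1..p} \<Longrightarrow> Q i \<noteq> {} \<and> convex (Q i) \<and> compact (Q i)"
  shows
    "(\<exists>u. is_arg_min (dual_objective p Q) (\<lambda>u. u \<in> polar_set F) u \<and>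
        minimal_time F 0 (\<Sum>i\<in>{1..p}. Q i) = - dual_objective p Q u)
   \<and> (\<forall>ub qb. is_arg_min (dual_objective p Q) (\<lambda>u. u \<in> polar_set F) ub \<longrightarrow>
        qb \<in> gen_projection F 0 (\<Sum>i\<in>{1..p}. Q i) \<longrightarrow>
          qb \<in> (\<Sum>i\<in>{1..p}. support_points (Q i) (- ub)) \<and>
          (\<exists>q. qb = (\<Sum>i\<in>{1..p}. q i) \<and>
             (\<forall>i\<in>{1..p}. q i \<in> Q i \<and> - ub \<in> normal_cone (q i) (Q i))))
   \<and> (F = cball 0 1 \<longrightarrow>
        (\<exists>u. is_arg_min (dual_objective p Q) (\<lambda>u. u \<in> cball 0 1) u \<and>
           ereal (infdist 0 (\<Sum>i\<in>{1..p}. Q i)) = - dual_objective p Q u) \<and>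
        (\<exists>qb. euclidean_projection 0 (\<Sum>i\<in>{1..p}. Q i) = {qb} \<and>
           gen_projection F 0 (\<Sum>i\<in>{1..p}. Q i) = {qb} \<and>
           (0 \<notin> (\<Sum>i\<in>{1..p}. Q i) \<longrightarrow>
              (\<forall>u. is_arg_min (dual_objective p Q) (\<lambda>u. u \<in> cball 0 1) u
                     \<longleftrightarrow> u = qb /\<^sub>R norm qb) \<and>
              qb \<in> (\<Sum>i\<in>{1..p}. support_points (Q i) (- qb)))))"
proof -
  let ?S = "\<Sum>i\<in>{1..p}. Q i"
  let ?D = "dual_objective p Q"
  let ?T = "minimal_time F 0 ?S"
  let ?argmin = "is_arg_min ?D (\<lambda>u. u \<in> polar_set F)"
  have D: "?D u = support_fun ?S (- u)" for u
    unfolding dual_objective_def using assms(6) by (subst support_fun_sum) auto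
  have comp: "compact ?S" and conv: "convex ?S"
    using assms(6) by (auto intro!: compact_set_sum convex_set_sum)
  then have cl: "closed ?S"
    by (simp add: compact_imp_closed)
  have "\<forall>i\<in>{1..p}. \<exists>x. x \<in> Q i"
    using assms(6) by (simp add: ex_in_conv)
  then have ne: "?S \<noteq> {}"
    by (auto simp: set_sum_alt dest: bchoice)
  obtain v where v: "v \<in> polar_set F" "?D v \<le> - ?T"
    unfolding D using strong_duality[OF assms(1,3,4) conv ne] by metis
  have weak: "- ?T \<le> ?D w" if "w \<in> polar_set F" for w
    unfolding D using that by (rule weak_duality)
  \<comment> \<open>The optimal value is -T, by weak duality and the point v, so minimality amounts
    to a vanishing duality gap.\<close>
  have argmin_iff: "?argmin u \<longleftrightarrow> u \<in> polar_set F \<and> ?D u = - ?T" for u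
    unfolding is_arg_min_linorder using v weak by (metis antisym order_trans)
  have ex: "\<exists>u. ?argmin u"
    unfolding argmin_iff using v weak by (metis antisym)
  have supp: "qb \<in> support_points ?S (- ub)"
    if ub: "?argmin ub" and qb: "qb \<in> gen_projection F 0 ?S" for ub qb
  proof -
    have qb': "qb \<in> ?S" "minkowski_fun F qb = ?T"
      using qb by (auto simp: gen_projection_def)
    \<comment> \<open>With T = -\<sigma>_S(-ub) this gives \<sigma>_S(-ub) \<le> <-ub,qb>, the
      nontrivial half of the claim that qb attains the supremum.\<close>
    have "ereal (ub \<bullet> qb) \<le> ?T"
      using inner_le_minkowski_fun[of ub F qb] ub qb' by (simp add: argmin_iff)
    moreover have "support_fun ?S (- ub) = - ?T"
      using ub by (simp add: argmin_iff D)
    ultimately have "support_fun ?S (- ub) \<le> ereal (- ub \<bullet> qb)"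
      by (simp add: ereal_uminus_le_reorder)
    moreover have "ereal (- ub \<bullet> qb) \<le> support_fun ?S (- ub)"
      unfolding support_fun_def using qb'(1) by (rule SUP_upper)
    ultimately show ?thesis
      using qb'(1) by (simp add: support_points_def)
  qed
  have part1: "\<exists>u. ?argmin u \<and> ?T = - ?D u"
    using ex by (auto simp: argmin_iff)
  have part2: "qb \<in> (\<Sum>i\<in>{1..p}. support_points (Q i) (- ub)) \<and>
      (\<exists>q. qb = (\<Sum>i\<in>{1..p}. q i) \<and>
        (\<forall>i\<in>{1..p}. q i \<in> Q i \<and> - ub \<in> normal_cone (q i) (Q i)))"
    if "?argmin ub" "qb \<in> gen_projection F 0 ?S" for ub qb
  proof -
    have *: "qb \<in> (\<Sum>i\<in>{1..p}. support_points (Q i) (- ub))"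
      using supp[OF that] support_points_sum[of "{1..p}"] by blast
    then obtain q where "qb = sum q {1..p}" "\<forall>i\<in>{1..p}. q i \<in> support_points (Q i) (- ub)"
      by (auto simp: set_sum_alt)
    then show ?thesis
      using * support_points_imp_normal_cone unfolding support_points_def by blast
  qed
  have part3: "(\<exists>u. is_arg_min ?D (\<lambda>u. u \<in> cball 0 1) u \<and> ereal (infdist 0 ?S) = - ?D u) \<and>
      (\<exists>qb. euclidean_projection 0 ?S = {qb} \<and> gen_projection F 0 ?S = {qb} \<and>
        (0 \<notin> ?S \<longrightarrow>
          (\<forall>u. is_arg_min ?D (\<lambda>u. u \<in> cball 0 1) u \<longleftrightarrow> u = qb /\<^sub>R norm qb) \<and>
          qb \<in> (\<Sum>i\<in>{1..p}. support_points (Q i) (- qb))))"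
    if F: "F = cball 0 1"
  proof -
    have polar: "polar_set F = cball 0 1"
      by (simp add: F polar_set_cball)
    have T: "?T = ereal (infdist 0 ?S)"
      unfolding F using cl ne by (rule minimal_time_cball)
    obtain qb where eproj: "euclidean_projection 0 ?S = {qb}"
      using euclidean_projection_unique[OF cl conv ne] .
    then have gproj: "gen_projection F 0 ?S = {qb}"
      unfolding F gen_projection_cball[OF cl ne] .
    have qb: "qb \<in> ?S" "infdist 0 ?S = norm qb"
      using eproj by (auto simp: euclidean_projection_def)
    have "(\<forall>u. ?argmin u \<longleftrightarrow> u = qb /\<^sub>R norm qb) \<and>
        qb \<in> (\<Sum>i\<in>{1..p}. support_points (Q i) (- qb))" if "0 \<notin> ?S"
    proof -
      have q0: "norm qb > 0"
        using that qb(1) by auto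
      \<comment> \<open>The vanishing gap gives <u,qb> = |qb|. With |u| \<le> 1 this is equality in
        Cauchy-Schwarz, so u is the unit vector along qb.\<close>
      have uniq: "u = qb /\<^sub>R norm qb" if u: "?argmin u" for u
      proof -
        have "norm u \<le> 1"
          using u[unfolded argmin_iff] polar by simp
        have "support_fun ?S (- u) = ereal (- u \<bullet> qb)"
          using supp[OF u] gproj by (intro support_fun_eq_inner) simp
        then have inner: "u \<bullet> qb = norm qb"
          using u unfolding argmin_iff D T qb(2) by simp
        then have "norm qb \<le> norm u * norm qb"
          using norm_cauchy_schwarz[of u qb] by simp
        then have "norm u = 1"
          using q0 \<open>norm u \<le> 1\<close> by simp
        then have "norm u *\<^sub>R qb = norm qb *\<^sub>R u"
          using inner norm_cauchy_schwarz_eq[of u qb] by simp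
        then have "qb = norm qb *\<^sub>R u"
          using \<open>norm u = 1\<close> by simp
        then show ?thesis
          using q0 by (metis divideR_right less_numeral_extra(3))
      qed
      \<comment> \<open>A minimizer exists and can only be this point, so its optimality requires no
        direct verification.\<close>
      then have iff: "?argmin u \<longleftrightarrow> u = qb /\<^sub>R norm qb" for u
        using ex by metis
      then have "qb \<in> (\<Sum>i\<in>{1..p}. support_points (Q i) (- (qb /\<^sub>R norm qb)))"
        using part2 gproj by blast
      moreover have "- (qb /\<^sub>R norm qb) = inverse (norm qb) *\<^sub>R (- qb)"
        by simp
      ultimately show ?thesis
        using iff q0 by (simp only: support_points_scaleR positive_imp_inverse_positive) simp
    qed
    then show ?thesis
      using part1 eproj gproj unfolding T polar by blast
  qed
  show ?thesis
    using part1 part2 part3 by blast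
qed

end
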